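(* There exists an absolute constant $a_1>0$ such that the following holds for every $N\in\mathbb{N}_0$ and every $\varepsilon\ge 0$. If $K,L\subset[0,1]^2$ are convex bodies satisfying \[\sum_{i,j=0}^N|\lambda_{ij}(K)-\lambda_{ij}(L)|^2\le\varepsilon^2,\] then \[\delta_N(K,L)\le\varepsilon^2+\frac{a_1}{N+1}.\]
   Context: A convex body is a compact, convex subset of $\mathbb{R}^2$ with nonempty interior. The shifted normalized Legendre polynomials $L_i:[0,1]\to\mathbb{R}$, $i\in\mathbb{N}_0$, are obtained by applying Gram-Schmidt orthonormalization in $L^2([0,1])$ to $1,x,x^2,\dots$. For a convex body $K\subset[0,1]^2$ and $i,j\in\mathbb{N}_0$, the Legendre moment is $\lambda_{ij}(K)=\int_K L_i(x_1)L_j(x_2)\,d(x_1,x_2)$. The Nikodym distance $\delta_N(K,L)$ is the area of the symmetric difference $(K\setminus L)\cup(L\setminus K)$ (the subscript in $\delta_N$ stands for Nikodym and is unrelated to the integer $N$). *)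

theory Defs
  imports "HOL-Analysis.Analysis"
begin

definition convex_body :: "(real \<times> real) set \<Rightarrow> bool" where
  "convex_body K \<longleftrightarrow> compact K \<and> convex K \<and> interior K \<noteq> {}"

definition unit_inner :: "(real \<Rightarrow> real) \<Rightarrow> (real \<Rightarrow> real) \<Rightarrow> real" where
  "unit_inner f g = (LINT t:{0..1}|lborel. f t * g t)"

(* Gram-Schmidt orthonormalization of 1, x, x^2, ... with respect to unit_inner: subtract from
   x^n its projections onto the previously constructed functions, then divide by the norm.
   The resulting functions are defined on all of real, but only their values on [0,1] are used. *)
fun shifted_legendre :: "nat \<Rightarrow> real \<Rightarrow> real" where
  "shifted_legendre n =
     (let p = (\<lambda>x. x ^ n -
                (\<Sum>i<n. unit_inner (\<lambda>t. t ^ n) (shifted_legendre i) * shifted_legendre i x))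
      in (\<lambda>x. p x / sqrt (unit_inner p p)))"

(* The recursive equation would loop as an unconditional simp rule. *)
declare shifted_legendre.simps [simp del]

definition legendre_moment :: "nat \<Rightarrow> nat \<Rightarrow> (real \<times> real) set \<Rightarrow> real" where
  "legendre_moment i j K =
     (LINT x:K|lborel. shifted_legendre i (fst x) * shifted_legendre j (snd x))"

definition nikodym_dist :: "(real \<times> real) set \<Rightarrow> (real \<times> real) set \<Rightarrow> real" where
  "nikodym_dist K L = measure lborel ((K - L) \<union> (L - K))"

end

theory Submission
  imports Defs "HOL-Computational_Algebra.Polynomial"
begin

text \<open>
  For \<open>f = 1\<^sub>K - 1\<^sub>L\<close> the Nikodym distance is \<open>\<parallel>f\<parallel>\<^sup>2\<close>, and the given moments are the
  coefficients of the projection of \<open>f\<close> onto polynomials of degree at most \<open>N\<close> in each variable.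
  The projections in the two variables commute, so the squared defect is at most the sum of the
  squared defects in each variable separately, and these can be computed section by section. Sections of
  convex sets are intervals, which reduces the claim to the approximation of one step function on
  \<open>[0, 1]\<close> by polynomials in \<open>L\<^sup>2\<close> with squared error \<open>O(1 / N)\<close>. In the variable
  \<open>x = (1 - cos \<theta>) / 2\<close> this is a cosine series whose \<open>k\<close>-th squared coefficient is \<open>O(1 / k\<^sup>2)\<close>.
\<close>

section \<open>Bounded measurable functions vanishing outside a set\<close>

text \<open>Integrability alone is not preserved by products. This bundle passes through sums,
  products, sections and, over compact sets, marginals, and it implies integrability when
  \<open>A\<close> is compact. Most integrability goals below thus reduce to closure rules.\<close>

definition bdd_supp :: "'a::euclidean_space set \<Rightarrow> ('a \<Rightarrow> real) \<Rightarrow> bool" where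
  "bdd_supp A f \<longleftrightarrow>
     f \<in> borel_measurable borel \<and> (\<exists>C. \<forall>x. \<bar>f x\<bar> \<le> C * indicator A x)"

lemma bdd_suppI:
  assumes "f \<in> borel_measurable borel" "\<And>x. x \<notin> A \<Longrightarrow> f x = 0" "\<And>x. x \<in> A \<Longrightarrow> \<bar>f x\<bar> \<le> C"
  shows "bdd_supp A f"
  unfolding bdd_supp_def using assms by (auto intro!: exI[of _ C] simp: indicator_def)

lemma bdd_suppE:
  assumes "bdd_supp A f"
  obtains C where "C \<ge> 0" "\<And>x. \<bar>f x\<bar> \<le> C" "\<And>x. x \<notin> A \<Longrightarrow> f x = 0"
    "f \<in> borel_measurable borel"
proof -
  from assms obtain C where C: "\<And>x. \<bar>f x\<bar> \<le> C * indicator A x"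
    and m: "f \<in> borel_measurable borel"
    by (auto simp: bdd_supp_def)
  show thesis
  \<comment> \<open>For empty \<open>A\<close> the constant in \<open>bdd_supp_def\<close> may be
    negative, hence the absolute value.\<close>
  proof (rule that[of "\<bar>C\<bar>"])
    show "\<bar>f x\<bar> \<le> \<bar>C\<bar>" for x
      using C[of x] by (cases "x \<in> A") auto
    show "x \<notin> A \<Longrightarrow> f x = 0" for x
      using C[of x] by auto
  qed (use m in auto)
qed

lemma bdd_supp_zero_outside: "bdd_supp A f \<Longrightarrow> x \<notin> A \<Longrightarrow> f x = 0"
  by (auto elim: bdd_suppE)

lemma bdd_supp_diff:
  assumes "bdd_supp A f" "bdd_supp A g"
  shows "bdd_supp A (\<lambda>x. f x - g x)"
proof -
  obtain C where C: "C \<ge> 0" "\<And>x. \<bar>f x\<bar> \<le> C" "\<And>x. x \<notin> A \<Longrightarrow> f x = 0"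
    "f \<in> borel_measurable borel" using assms(1) by (rule bdd_suppE) blast
  obtain D where D: "D \<ge> 0" "\<And>x. \<bar>g x\<bar> \<le> D" "\<And>x. x \<notin> A \<Longrightarrow> g x = 0"
    "g \<in> borel_measurable borel" using assms(2) by (rule bdd_suppE) blast
  show ?thesis
  proof (rule bdd_suppI)
    show "\<bar>f x - g x\<bar> \<le> C + D" for x
      using C(2)[of x] D(2)[of x] by linarith
  qed (use C D in auto)
qed

lemma bdd_supp_add:
  assumes "bdd_supp A f" "bdd_supp A g"
  shows "bdd_supp A (\<lambda>x. f x + g x)"
proof -
  obtain C where C: "C \<ge> 0" "\<And>x. \<bar>f x\<bar> \<le> C" "\<And>x. x \<notin> A \<Longrightarrow> f x = 0"
    "f \<in> borel_measurable borel" using assms(1) by (rule bdd_suppE) blast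
  obtain D where D: "D \<ge> 0" "\<And>x. \<bar>g x\<bar> \<le> D" "\<And>x. x \<notin> A \<Longrightarrow> g x = 0"
    "g \<in> borel_measurable borel" using assms(2) by (rule bdd_suppE) blast
  show ?thesis
  proof (rule bdd_suppI)
    show "\<bar>f x + g x\<bar> \<le> C + D" for x
      using C(2)[of x] D(2)[of x] by linarith
  qed (use C D in auto)
qed

lemma bdd_supp_mult:
  assumes "bdd_supp A f" "bdd_supp A g"
  shows "bdd_supp A (\<lambda>x. f x * g x)"
proof -
  obtain C where C: "C \<ge> 0" "\<And>x. \<bar>f x\<bar> \<le> C" "\<And>x. x \<notin> A \<Longrightarrow> f x = 0"
    "f \<in> borel_measurable borel" using assms(1) by (rule bdd_suppE) blast
  obtain D where D: "D \<ge> 0" "\<And>x. \<bar>g x\<bar> \<le> D" "\<And>x. x \<notin> A \<Longrightarrow> g x = 0"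
    "g \<in> borel_measurable borel" using assms(2) by (rule bdd_suppE) blast
  show ?thesis
  proof (rule bdd_suppI)
    show "\<bar>f x * g x\<bar> \<le> C * D" for x
      unfolding abs_mult using C D by (intro mult_mono) auto
  qed (use C D in auto)
qed

lemma bdd_supp_cmult: "bdd_supp A f \<Longrightarrow> bdd_supp A (\<lambda>x. c * f x)"
proof -
  assume "bdd_supp A f"
  then obtain C where C: "C \<ge> 0" "\<And>x. \<bar>f x\<bar> \<le> C" "\<And>x. x \<notin> A \<Longrightarrow> f x = 0"
    "f \<in> borel_measurable borel" by (rule bdd_suppE) blast
  show ?thesis
  proof (rule bdd_suppI)
    show "\<bar>c * f x\<bar> \<le> \<bar>c\<bar> * C" for x
      unfolding abs_mult using C by (intro mult_left_mono) auto
  qed (use C in auto)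
qed

lemma bdd_supp_power2: "bdd_supp A f \<Longrightarrow> bdd_supp A (\<lambda>x. (f x)\<^sup>2)"
  unfolding power2_eq_square by (rule bdd_supp_mult)

lemma bdd_supp_sum:
  "(\<And>i. i \<in> I \<Longrightarrow> bdd_supp A (f i)) \<Longrightarrow> bdd_supp A (\<lambda>x. \<Sum>i\<in>I. f i x)"
proof (induction I rule: infinite_finite_induct)
  case (insert i I)
  then show ?case by (simp add: bdd_supp_add)
qed (auto intro!: bdd_suppI[of _ _ 0])

lemma bdd_supp_indicator:
  assumes "B \<in> sets borel" "B \<subseteq> A"
  shows "bdd_supp A (indicator B)"
  using assms by (intro bdd_suppI[of _ _ 1]) (auto simp: indicator_def)

lemma bdd_supp_indicator_continuous:
  assumes "compact A" "continuous_on A f"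
  shows "bdd_supp A (\<lambda>x. indicator A x * f x)"
proof -
  have "bounded (f ` A)"
    using assms by (intro compact_imp_bounded compact_continuous_image)
  then obtain C where "\<And>x. x \<in> A \<Longrightarrow> \<bar>f x\<bar> \<le> C"
    unfolding bounded_iff by auto
  moreover have "(\<lambda>x. indicator A x * f x) \<in> borel_measurable borel"
    using borel_measurable_continuous_on_indicator[of A f] assms
    by (simp add: compact_imp_closed)
  ultimately show ?thesis
    by (intro bdd_suppI[of _ _ C]) auto
qed

lemma integrable_indicator_compact:
  assumes "compact (A :: 'a::euclidean_space set)"
  shows "integrable lborel (indicator A :: 'a \<Rightarrow> real)"
  by (rule integrable_real_indicator)
    (use assms emeasure_compact_finite in \<open>auto intro: borel_compact\<close>)

lemma bdd_supp_integrable: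
  assumes "compact A" "bdd_supp A f"
  shows "integrable lborel f"
proof -
  obtain C where C: "\<And>x. \<bar>f x\<bar> \<le> C * indicator A x" and m: "f \<in> borel_measurable borel"
    using assms(2) by (auto simp: bdd_supp_def)
  have "integrable lborel (\<lambda>x. C * indicator A x)"
    using assms(1) by (intro integrable_mult_right integrable_indicator_compact)
  then show ?thesis
    by (rule Bochner_Integration.integrable_bound) (use m C in \<open>auto intro: order_trans[OF _ abs_ge_self]\<close>)
qed

lemma bdd_supp_prod:
  fixes f :: "'a::euclidean_space \<Rightarrow> real" and g :: "'b::euclidean_space \<Rightarrow> real"
  assumes "bdd_supp A f" "bdd_supp B g"
  shows "bdd_supp (A \<times> B) (\<lambda>z. f (fst z) * g (snd z))"
proof -
  obtain C where C: "C \<ge> 0" "\<And>x. \<bar>f x\<bar> \<le> C" "\<And>x. x \<notin> A \<Longrightarrow> f x = 0"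
    "f \<in> borel_measurable borel" using assms(1) by (rule bdd_suppE) blast
  obtain D where D: "D \<ge> 0" "\<And>x. \<bar>g x\<bar> \<le> D" "\<And>x. x \<notin> B \<Longrightarrow> g x = 0"
    "g \<in> borel_measurable borel" using assms(2) by (rule bdd_suppE) blast
  show ?thesis
  proof (rule bdd_suppI)
    show "\<bar>f (fst z) * g (snd z)\<bar> \<le> C * D" for z
      unfolding abs_mult using C D by (intro mult_mono) auto
    have [measurable]: "f \<in> borel_measurable borel" "g \<in> borel_measurable borel"
      using C D by auto
    show "(\<lambda>z. f (fst z) * g (snd z)) \<in> borel_measurable borel"
      unfolding borel_prod[symmetric] by measurable
    show "f (fst z) * g (snd z) = 0" if "z \<notin> A \<times> B" for z
      using that C(3)[of "fst z"] D(3)[of "snd z"] by (cases z) auto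
  qed
qed

lemma bdd_supp_swap:
  fixes f :: "'a::euclidean_space \<times> 'b::euclidean_space \<Rightarrow> real"
  assumes "bdd_supp (A \<times> B) f"
  shows "bdd_supp (B \<times> A) (\<lambda>z. f (snd z, fst z))"
proof -
  obtain C where C: "C \<ge> 0" "\<And>x. \<bar>f x\<bar> \<le> C" "\<And>x. x \<notin> A \<times> B \<Longrightarrow> f x = 0"
    "f \<in> borel_measurable borel" using assms(1) by (rule bdd_suppE) blast
  have [measurable]: "f \<in> borel_measurable (borel \<Otimes>\<^sub>M borel)"
    using C(4) by (simp add: borel_prod)
  show ?thesis
  proof (rule bdd_suppI)
    show "(\<lambda>z. f (snd z, fst z)) \<in> borel_measurable borel"
      unfolding borel_prod[symmetric] by measurable
    show "f (snd z, fst z) = 0" if "z \<notin> B \<times> A" for z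
      using that by (intro C(3)) (cases z, auto)
  qed (rule C(2))
qed

lemma bdd_supp_section:
  fixes f :: "'a::euclidean_space \<times> 'b::euclidean_space \<Rightarrow> real"
  assumes "bdd_supp (A \<times> B) f"
  shows "bdd_supp A (\<lambda>x. f (x, y))"
proof -
  obtain C where C: "C \<ge> 0" "\<And>x. \<bar>f x\<bar> \<le> C" "\<And>x. x \<notin> A \<times> B \<Longrightarrow> f x = 0"
    "f \<in> borel_measurable borel" using assms(1) by (rule bdd_suppE) blast
  have [measurable]: "f \<in> borel_measurable (borel \<Otimes>\<^sub>M borel)"
    using C(4) by (simp add: borel_prod)
  show ?thesis
    by (rule bdd_suppI) (use C in auto)
qed

text \<open>A bound \<open>C\<close> on \<open>f\<close> gives the bound \<open>C\<close> times the
  measure of \<open>A\<close> on the marginal, finite by compactness.\<close>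

lemma bdd_supp_marginal:
  fixes f :: "'a::euclidean_space \<times> 'b::euclidean_space \<Rightarrow> real"
  assumes A: "compact A" and f: "bdd_supp (A \<times> B) f"
  shows "bdd_supp B (\<lambda>y. \<integral>x. f (x, y) \<partial>lborel)"
proof -
  obtain C where C: "C \<ge> 0" "\<And>x. \<bar>f x\<bar> \<le> C" "\<And>x. x \<notin> A \<times> B \<Longrightarrow> f x = 0"
    "f \<in> borel_measurable borel" using f by (rule bdd_suppE) blast
  have fm [measurable]: "f \<in> borel_measurable (borel \<Otimes>\<^sub>M borel)"
    using C(4) by (simp add: borel_prod)
  have iA: "integrable lborel (\<lambda>x. C * indicator A x)"
    using A by (intro integrable_mult_right integrable_indicator_compact)
  show ?thesis
  proof (rule bdd_suppI)
    show "(\<lambda>y. \<integral>x. f (x, y) \<partial>lborel) \<in> borel_measurable borel"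
      by (rule lborel.borel_measurable_lebesgue_integral) (use fm in measurable)
    show "(\<integral>x. f (x, y) \<partial>lborel) = 0" if "y \<notin> B" for y
      using that C(3) by simp
    show "\<bar>\<integral>x. f (x, y) \<partial>lborel\<bar> \<le> (\<integral>x. C * indicator A x \<partial>lborel)" for y
    proof -
      have "\<bar>\<integral>x. f (x, y) \<partial>lborel\<bar> \<le> (\<integral>x. \<bar>f (x, y)\<bar> \<partial>lborel)"
        by (rule integral_abs_bound)
      also have "\<dots> \<le> (\<integral>x. C * indicator A x \<partial>lborel)"
      proof (rule integral_mono[OF _ iA])
        show "integrable lborel (\<lambda>x. \<bar>f (x, y)\<bar>)"
          using bdd_supp_integrable[OF A bdd_supp_section[OF f]] by auto
        show "\<bar>f (x, y)\<bar> \<le> C * indicator A x" for x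
          using C(2)[of "(x, y)"] C(3)[of "(x, y)"] by (auto simp: indicator_def)
      qed
      finally show ?thesis .
    qed
  qed
qed

lemma bdd_supp_Fubini:
  fixes f :: "'a::euclidean_space \<times> 'b::euclidean_space \<Rightarrow> real"
  assumes "compact A" "compact B" "bdd_supp (A \<times> B) f"
  shows "(\<integral>y. (\<integral>x. f (x, y) \<partial>lborel) \<partial>lborel) = integral\<^sup>L lborel f"
    and "(\<integral>x. (\<integral>y. f (x, y) \<partial>lborel) \<partial>lborel) = integral\<^sup>L lborel f"
proof -
  have i: "integrable (lborel \<Otimes>\<^sub>M lborel) (\<lambda>(x, y). f (x, y))"
    using bdd_supp_integrable[OF compact_Times[OF assms(1,2)] assms(3)]
    by (simp add: lborel_prod)
  show "(\<integral>y. (\<integral>x. f (x, y) \<partial>lborel) \<partial>lborel) = integral\<^sup>L lborel f"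
    using lborel_pair.integral_snd[OF i] by (simp add: lborel_prod)
  show "(\<integral>x. (\<integral>y. f (x, y) \<partial>lborel) \<partial>lborel) = integral\<^sup>L lborel f"
    using lborel_pair.integral_fst[OF i] by (simp add: lborel_prod)
qed

subsection \<open>Orthonormal systems\<close>

text \<open>Instantiated twice below: by cosines on [0, pi] and by Legendre polynomials on [0, 1].
  The functions are cut off outside \<open>A\<close>, so that all integrals run over the whole
  line.\<close>

locale orthonormal_system =
  fixes A :: "real set" and e :: "nat \<Rightarrow> real \<Rightarrow> real"
  assumes compact_A: "compact A"
    and bdd: "bdd_supp A (e i)"
    and orth: "(\<integral>x. e i x * e j x \<partial>lborel) = (if i = j then 1 else 0)"
begin

text \<open>Kept for arbitrary coefficients \<open>b\<close>: the Fourier coefficients yield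
  Pythagoras and Bessel, general ones yield the best approximation property.\<close>

lemma integral_diff_combination_square:
  assumes I: "finite I" and f: "bdd_supp A f"
  shows "(\<integral>x. (f x - (\<Sum>i\<in>I. b i * e i x))\<^sup>2 \<partial>lborel) =
    (\<integral>x. (f x)\<^sup>2 \<partial>lborel) - 2 * (\<Sum>i\<in>I. b i * (\<integral>x. f x * e i x \<partial>lborel)) + (\<Sum>i\<in>I. (b i)\<^sup>2)"
proof -
  note int = bdd_supp_integrable[OF compact_A]
  have 1: "integrable lborel (\<lambda>x. (f x)\<^sup>2)"
    by (intro int bdd_supp_power2 f)
  have 2: "integrable lborel (\<lambda>x. b i * (f x * e i x))" for i
    by (intro int bdd_supp_cmult bdd_supp_mult f bdd)
  have 3: "integrable lborel (\<lambda>x. b i * b j * (e i x * e j x))" for i j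
    by (intro int bdd_supp_cmult bdd_supp_mult bdd)
  have "(f x - (\<Sum>i\<in>I. b i * e i x))\<^sup>2 =
      (f x)\<^sup>2 - 2 * (\<Sum>i\<in>I. b i * (f x * e i x)) + (\<Sum>i\<in>I. \<Sum>j\<in>I. b i * b j * (e i x * e j x))" for x
    by (simp add: power2_diff) (simp add: power2_eq_square sum_product sum_distrib_left mult_ac)
  then have "(\<integral>x. (f x - (\<Sum>i\<in>I. b i * e i x))\<^sup>2 \<partial>lborel) =
      (\<integral>x. (f x)\<^sup>2 \<partial>lborel) - 2 * (\<Sum>i\<in>I. \<integral>x. b i * (f x * e i x) \<partial>lborel)
       + (\<Sum>i\<in>I. \<Sum>j\<in>I. \<integral>x. b i * b j * (e i x * e j x) \<partial>lborel)"
    using 1 2 3 by (simp del: integral_mult_right_zero)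
  also have "(\<Sum>i\<in>I. \<Sum>j\<in>I. \<integral>x. b i * b j * (e i x * e j x) \<partial>lborel) = (\<Sum>i\<in>I. (b i)\<^sup>2)"
    using I by (simp add: orth power2_eq_square if_distrib cong: if_cong)
  finally show ?thesis by simp
qed

lemma integral_diff_projection_square:
  assumes "finite I" "bdd_supp A f"
  shows "(\<integral>x. (f x - (\<Sum>i\<in>I. (\<integral>t. f t * e i t \<partial>lborel) * e i x))\<^sup>2 \<partial>lborel) =
    (\<integral>x. (f x)\<^sup>2 \<partial>lborel) - (\<Sum>i\<in>I. (\<integral>t. f t * e i t \<partial>lborel)\<^sup>2)"
  unfolding integral_diff_combination_square[OF assms] by (simp add: power2_eq_square)

lemma Bessel_inequality:
  assumes "finite I" "bdd_supp A f"
  shows "(\<Sum>i\<in>I. (\<integral>t. f t * e i t \<partial>lborel)\<^sup>2) \<le> (\<integral>x. (f x)\<^sup>2 \<partial>lborel)"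
proof -
  have "0 \<le> (\<integral>x. (f x - (\<Sum>i\<in>I. (\<integral>t. f t * e i t \<partial>lborel) * e i x))\<^sup>2 \<partial>lborel)"
    by (rule Bochner_Integration.integral_nonneg) simp
  then show ?thesis
    unfolding integral_diff_projection_square[OF assms] by linarith
qed

text \<open>The two sides differ by the sum of the squares of (Fourier coefficient minus
  \<open>b i\<close>). Any explicit approximant therefore bounds the defect.\<close>

lemma projection_defect_le:
  assumes "finite I" "bdd_supp A f"
  shows "(\<integral>x. (f x)\<^sup>2 \<partial>lborel) - (\<Sum>i\<in>I. (\<integral>t. f t * e i t \<partial>lborel)\<^sup>2) \<le>
    (\<integral>x. (f x - (\<Sum>i\<in>I. b i * e i x))\<^sup>2 \<partial>lborel)"
proof -
  have "0 \<le> (\<Sum>i\<in>I. ((\<integral>t. f t * e i t \<partial>lborel) - b i)\<^sup>2)"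
    by (simp add: sum_nonneg)
  also have "\<dots> = (\<Sum>i\<in>I. (\<integral>t. f t * e i t \<partial>lborel)\<^sup>2)
      - 2 * (\<Sum>i\<in>I. b i * (\<integral>t. f t * e i t \<partial>lborel)) + (\<Sum>i\<in>I. (b i)\<^sup>2)"
    by (simp add: power2_diff sum.distrib sum_subtractf sum_distrib_left mult_ac)
  finally show ?thesis
    unfolding integral_diff_combination_square[OF assms] by linarith
qed

text \<open>
  With \<open>C i y\<close> and \<open>D j x\<close> the coefficients of the sections, \<open>hor\<close> leaves only
  \<open>\<Sum>i\<in>I. \<parallel>C i - (projection of C i)\<parallel>\<^sup>2\<close> to be bounded. These differences are the
  \<open>x\<close>-coefficients of \<open>h\<close>, the defect of \<open>f\<close> in the variable \<open>y\<close>, so Bessel and \<open>ver\<close> apply.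
\<close>

lemma square_integral_le_of_sections:
  assumes I: "finite I" and f: "bdd_supp (A \<times> A) f" and c: "c \<ge> 0"
    and hor: "\<And>y. y \<in> A \<Longrightarrow> (\<integral>x. (f (x, y))\<^sup>2 \<partial>lborel) \<le>
        (\<Sum>i\<in>I. (\<integral>x. f (x, y) * e i x \<partial>lborel)\<^sup>2) + c"
    and ver: "\<And>x. x \<in> A \<Longrightarrow> (\<integral>y. (f (x, y))\<^sup>2 \<partial>lborel) \<le>
        (\<Sum>j\<in>I. (\<integral>y. f (x, y) * e j y \<partial>lborel)\<^sup>2) + c"
  shows "(\<integral>z. (f z)\<^sup>2 \<partial>lborel) \<le>
    (\<Sum>i\<in>I. \<Sum>j\<in>I. (\<integral>z. f z * (e i (fst z) * e j (snd z)) \<partial>lborel)\<^sup>2) + 2 * c * measure lborel A"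
proof -
  note int = bdd_supp_integrable[OF compact_A]
  note Fub = bdd_supp_Fubini[OF compact_A compact_A]
  define C where "C i y = (\<integral>x. f (x, y) * e i x \<partial>lborel)" for i y
  define D where "D j x = (\<integral>y. f (x, y) * e j y \<partial>lborel)" for j x
  define l where "l i j = (\<integral>z. f z * (e i (fst z) * e j (snd z)) \<partial>lborel)" for i j
  define h where "h z = f z - (\<Sum>j\<in>I. D j (fst z) * e j (snd z))" for z
  have indA: "bdd_supp A (indicator A)"
    using compact_A by (intro bdd_supp_indicator) (auto simp: borel_compact)
  have int_indA: "(\<integral>x. c * indicator A x \<partial>lborel) = c * measure lborel A"
    using compact_A by (simp add: borel_compact emeasure_compact_finite)
  \<comment> \<open>\<open>e i (fst z)\<close> alone does not vanish off the square, because the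
    second coordinate is free. The indicator of \<open>A\<close> in that coordinate repairs this and
    is absorbed by \<open>f\<close>.\<close>
  have fe: "bdd_supp (A \<times> A) (\<lambda>z. f z * e i (fst z))" for i
  proof -
    have "bdd_supp (A \<times> A) (\<lambda>z. f z * (e i (fst z) * indicator A (snd z)))"
      by (intro bdd_supp_mult f bdd_supp_prod bdd indA)
    moreover have "f z * (e i (fst z) * indicator A (snd z)) = f z * e i (fst z)" for z
      using bdd_supp_zero_outside[OF f, of z] by (cases z) (auto simp: indicator_def)
    ultimately show ?thesis by simp
  qed
  have ef: "bdd_supp (A \<times> A) (\<lambda>z. f z * e j (snd z))" for j
  proof -
    have "bdd_supp (A \<times> A) (\<lambda>z. f z * (indicator A (fst z) * e j (snd z)))"
      by (intro bdd_supp_mult f bdd_supp_prod bdd indA)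
    moreover have "f z * (indicator A (fst z) * e j (snd z)) = f z * e j (snd z)" for z
      using bdd_supp_zero_outside[OF f, of z] by (cases z) (auto simp: indicator_def)
    ultimately show ?thesis by simp
  qed
  have C: "bdd_supp A (C i)" for i
    unfolding C_def using bdd_supp_marginal[OF compact_A fe[of i]] by simp
  have D: "bdd_supp A (D j)" for j
    unfolding D_def using bdd_supp_marginal[OF compact_A bdd_supp_swap[OF ef[of j]]] by simp
  have lb: "bdd_supp (A \<times> A) (\<lambda>z. f z * (e i (fst z) * e j (snd z)))" for i j
    by (intro bdd_supp_mult f bdd_supp_prod bdd)
  \<comment> \<open>The two orders of integration present the same number \<open>l i j\<close> as a
    coefficient of \<open>C i\<close> and of \<open>D j\<close>; this is the commutation of the two
    projections.\<close>
  have lC: "l i j = (\<integral>y. C i y * e j y \<partial>lborel)" for i j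
    unfolding l_def C_def Fub(1)[OF lb, symmetric] 
    by (simp only: fst_conv snd_conv mult.assoc[symmetric] integral_mult_left_zero)
  have lD: "l i j = (\<integral>x. D j x * e i x \<partial>lborel)" for i j
    unfolding l_def D_def Fub(2)[OF lb, symmetric] 
    by (simp only: fst_conv snd_conv mult.commute[of "e i _"] mult.assoc[symmetric] integral_mult_left_zero)
  have h: "bdd_supp (A \<times> A) h"
    unfolding h_def by (intro bdd_supp_diff f bdd_supp_sum bdd_supp_prod D bdd)
  have swap: "bdd_supp A (\<lambda>y. g (x, y))" if "bdd_supp (A \<times> A) g" for g :: "real \<times> real \<Rightarrow> real" and x
    using bdd_supp_section[OF bdd_supp_swap[OF that]] by simp
  have f2: "bdd_supp (A \<times> A) (\<lambda>z. (f z)\<^sup>2)" and h2: "bdd_supp (A \<times> A) (\<lambda>z. (h z)\<^sup>2)"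
    by (intro bdd_supp_power2 f h)+

  have "(\<integral>z. (f z)\<^sup>2 \<partial>lborel) = (\<integral>y. \<integral>x. (f (x, y))\<^sup>2 \<partial>lborel \<partial>lborel)"
    using Fub(1)[OF f2] by simp
  also have "\<dots> \<le> (\<integral>y. (\<Sum>i\<in>I. (C i y)\<^sup>2) + c * indicator A y \<partial>lborel)"
  proof (rule integral_mono)
    show "integrable lborel (\<lambda>y. \<integral>x. (f (x, y))\<^sup>2 \<partial>lborel)"
      by (intro int bdd_supp_marginal[OF compact_A f2])
    show "integrable lborel (\<lambda>y. (\<Sum>i\<in>I. (C i y)\<^sup>2) + c * indicator A y)"
      by (intro int bdd_supp_add bdd_supp_sum bdd_supp_power2 C bdd_supp_cmult indA)
    show "(\<integral>x. (f (x, y))\<^sup>2 \<partial>lborel) \<le> (\<Sum>i\<in>I. (C i y)\<^sup>2) + c * indicator A y" for y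
      using hor[of y] bdd_supp_zero_outside[OF f, of "(_, y)"]
      by (cases "y \<in> A") (auto simp: C_def sum_nonneg)
  qed
  also have "\<dots> = (\<Sum>i\<in>I. \<integral>y. (C i y)\<^sup>2 \<partial>lborel) + c * measure lborel A"
  proof -
    have "integrable lborel (\<lambda>y. \<Sum>i\<in>I. (C i y)\<^sup>2)" "integrable lborel (\<lambda>y. c * indicator A y)"
      "\<And>i. integrable lborel (\<lambda>y. (C i y)\<^sup>2)"
      by (intro int bdd_supp_sum bdd_supp_power2 C bdd_supp_cmult indA)+
    then show ?thesis using int_indA by simp
  qed
  finally have 1: "(\<integral>z. (f z)\<^sup>2 \<partial>lborel) \<le> (\<Sum>i\<in>I. \<integral>y. (C i y)\<^sup>2 \<partial>lborel) + c * measure lborel A" .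

  \<comment> \<open>By Pythagoras in the variable y, the left side is the defect of the section of
    \<open>f\<close> at \<open>x\<close>, which \<open>ver\<close> bounds.\<close>
  have 2: "(\<integral>y. (h (x, y))\<^sup>2 \<partial>lborel) \<le> c * indicator A x" for x
  proof (cases "x \<in> A")
    case True
    then show ?thesis
      using ver[of x] integral_diff_projection_square[OF I swap[OF f, of x]]
      by (simp add: h_def D_def)
  next
    case False
    then show ?thesis using bdd_supp_zero_outside[OF h, of "(x, _)"] by simp
  qed
  have coef: "(\<integral>x. h (x, y) * e i x \<partial>lborel) = C i y - (\<Sum>j\<in>I. l i j * e j y)" for i y
  proof -
    have "integrable lborel (\<lambda>x. f (x, y) * e i x)"
      by (intro int bdd_supp_mult bdd_supp_section[OF f] bdd)
    moreover have "integrable lborel (\<lambda>x. D j x * e i x * e j y)" for j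
      using int[OF bdd_supp_mult[OF D bdd], of j i] by simp
    moreover have "h (x, y) * e i x = f (x, y) * e i x - (\<Sum>j\<in>I. D j x * e i x * e j y)" for x
      by (simp add: h_def algebra_simps sum_distrib_left)
    ultimately show ?thesis
      by (simp add: C_def lD)
  qed
  have "(\<Sum>i\<in>I. \<integral>y. (C i y)\<^sup>2 \<partial>lborel) - (\<Sum>i\<in>I. \<Sum>j\<in>I. (l i j)\<^sup>2) =
      (\<Sum>i\<in>I. \<integral>y. (C i y - (\<Sum>j\<in>I. l i j * e j y))\<^sup>2 \<partial>lborel)"
    unfolding sum_subtractf[symmetric] lC integral_diff_projection_square[OF I C] ..
  also have "\<dots> = (\<integral>y. (\<Sum>i\<in>I. (C i y - (\<Sum>j\<in>I. l i j * e j y))\<^sup>2) \<partial>lborel)"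
    by (subst Bochner_Integration.integral_sum)
      (auto intro!: int bdd_supp_power2 bdd_supp_diff C bdd_supp_sum bdd_supp_cmult bdd)
  also have "\<dots> \<le> (\<integral>y. \<integral>x. (h (x, y))\<^sup>2 \<partial>lborel \<partial>lborel)"
  proof (rule integral_mono)
    show "integrable lborel (\<lambda>y. \<Sum>i\<in>I. (C i y - (\<Sum>j\<in>I. l i j * e j y))\<^sup>2)"
      by (intro int bdd_supp_power2 bdd_supp_diff C bdd_supp_sum bdd_supp_cmult bdd)
    show "integrable lborel (\<lambda>y. \<integral>x. (h (x, y))\<^sup>2 \<partial>lborel)"
      by (intro int bdd_supp_marginal[OF compact_A h2])
    show "(\<Sum>i\<in>I. (C i y - (\<Sum>j\<in>I. l i j * e j y))\<^sup>2) \<le> (\<integral>x. (h (x, y))\<^sup>2 \<partial>lborel)" for y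
      using Bessel_inequality[OF I bdd_supp_section[OF h, of y]] by (simp add: coef)
  qed
  \<comment> \<open>Bessel was applied in x for fixed y, while \<open>2\<close> integrates in y for
    fixed x.\<close>
  also have "\<dots> = (\<integral>x. \<integral>y. (h (x, y))\<^sup>2 \<partial>lborel \<partial>lborel)"
    using Fub[OF h2] by simp
  also have "\<dots> \<le> (\<integral>x. c * indicator A x \<partial>lborel)"
  proof (rule integral_mono)
    show "integrable lborel (\<lambda>x. \<integral>y. (h (x, y))\<^sup>2 \<partial>lborel)"
      using int[OF bdd_supp_marginal[OF compact_A bdd_supp_swap[OF h2]]] by simp
    show "integrable lborel (\<lambda>x. c * indicator A x :: real)"
      by (intro int bdd_supp_cmult indA)
  qed (rule 2)
  finally have "(\<Sum>i\<in>I. \<integral>y. (C i y)\<^sup>2 \<partial>lborel) - (\<Sum>i\<in>I. \<Sum>j\<in>I. (l i j)\<^sup>2) \<le> c * measure lborel A"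
    unfolding int_indA .
  with 1 show ?thesis unfolding l_def by linarith
qed

end

subsection \<open>Cosine approximation of a step\<close>

text \<open>Used for the gap in Parseval's identity and for the definiteness of
  \<open>unit_inner\<close> on polynomials. The Lebesgue integral is turned into a gauge integral,
  where the vanishing result is available.\<close>

lemma continuous_nonneg_integral_0:
  fixes f :: "real \<Rightarrow> real"
  assumes "a < b" "continuous_on {a..b} f" "\<And>x. x \<in> {a..b} \<Longrightarrow> 0 \<le> f x"
    and "(\<integral>x. indicator {a..b} x * f x \<partial>lborel) = 0" "x \<in> {a..b}"
  shows "f x = 0"
proof -
  have "set_integrable lborel {a..b} f"
    using assms(2) by (rule borel_integrable_atLeastAtMost')
  then have "f integrable_on {a..b}" "integral {a..b} f = 0"
    using set_borel_integral_eq_integral[of "{a..b}" f] assms(4)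
    by (auto simp: set_lebesgue_integral_def)
  then have "(f has_integral 0) (cbox a b)"
    by (simp add: has_integral_iff)
  then show ?thesis
    using assms by (intro has_integral_0_cbox_imp_0[of a b f]) auto
qed

lemma integral_indicator_cos:
  fixes a c :: real
  assumes "0 \<le> a"
  shows "(\<integral>x. indicator {0..a} x * cos (c * x) \<partial>lborel) = (if c = 0 then a else sin (c * a) / c)"
proof (cases "c = 0")
  case False
  have "(\<integral>x. indicator {0..a} x *\<^sub>R cos (c * x) \<partial>lborel) = sin (c * a) / c - sin (c * 0) / c"
    by (rule integral_FTC_atLeastAtMost[where F = "\<lambda>x. sin (c * x) / c"])
      (use assms in \<open>auto intro!: derivative_eq_intros continuous_intros simp: False
        simp flip: has_real_derivative_iff_has_vector_derivative\<close>)
  then show ?thesis using False by simp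
qed (use assms in simp)

text \<open>The frequency is an integer rather than a natural number, so that the difference
  frequency in the product formula for cosines is covered too.\<close>

lemma integral_cos_multiple:
  fixes m :: int
  shows "(\<integral>x. indicator {0..pi} x * cos (of_int m * x) \<partial>lborel) = (if m = 0 then pi else 0)"
  by (simp add: integral_indicator_cos sin_times_pi_eq_0)

definition cos_system :: "nat \<Rightarrow> real \<Rightarrow> real" where
  "cos_system k x = indicator {0..pi} x * (sqrt ((if k = 0 then 1 else 2) / pi) * cos (real k * x))"

lemma integral_cos_mult_cos:
  "(\<integral>x. indicator {0..pi} x * (cos (real j * x) * cos (real k * x)) \<partial>lborel) =
     (if j = k then if k = 0 then pi else pi / 2 else 0)"
proof -
  have i: "integrable lborel (\<lambda>x. indicator {0..pi} x * cos (real_of_int m * x))" for m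
    by (intro bdd_supp_integrable[of "{0..pi}"] bdd_supp_indicator_continuous) (auto intro!: continuous_intros)
  have "indicator {0..pi} x * (cos (real j * x) * cos (real k * x)) =
      (indicator {0..pi} x * cos (of_int (int j - int k) * x) +
       indicator {0..pi} x * cos (of_int (int j + int k) * x)) / 2" for x
    by (simp add: cos_times_cos algebra_simps)
  then have "(\<integral>x. indicator {0..pi} x * (cos (real j * x) * cos (real k * x)) \<partial>lborel) =
      ((\<integral>x. indicator {0..pi} x * cos (of_int (int j - int k) * x) \<partial>lborel) +
       (\<integral>x. indicator {0..pi} x * cos (of_int (int j + int k) * x) \<partial>lborel)) / 2"
    by (simp only: integral_divide_zero Bochner_Integration.integral_add[OF i i])
  then show ?thesis
    unfolding integral_cos_multiple by auto
qed

interpretation cosine: orthonormal_system "{0..pi}" cos_system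
proof
  show "bdd_supp {0..pi} (cos_system i)" for i
    unfolding cos_system_def
    by (intro bdd_supp_indicator_continuous) (auto intro!: continuous_intros)
  show "(\<integral>x. cos_system i x * cos_system j x \<partial>lborel) = (if i = j then 1 else 0)" for i j
  proof -
    let ?s = "\<lambda>k::nat. sqrt ((if k = 0 then 1 else 2) / pi)"
    have "cos_system i x * cos_system j x =
        ?s i * ?s j * (indicator {0..pi} x * (cos (real i * x) * cos (real j * x)))" for x
      by (simp add: cos_system_def indicator_def)
    then have "(\<integral>x. cos_system i x * cos_system j x \<partial>lborel) =
        ?s i * ?s j * (if i = j then if j = 0 then pi else pi / 2 else 0)"
      by (simp only: integral_mult_right_zero integral_cos_mult_cos)
    also have "\<dots> = (if i = j then 1 else 0)"
      by (cases "i = j") auto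
    finally show ?thesis .
  qed
qed simp

lemma integral_step_mult_cos_system:
  assumes "0 \<le> a" "a \<le> pi"
  shows "(\<integral>x. indicator {0..a} x * cos_system k x \<partial>lborel) =
     (if k = 0 then a / sqrt pi else sqrt (2 / pi) * (sin (real k * a) / real k))"
proof -
  have "indicator {0..a} x * cos_system k x =
      sqrt ((if k = 0 then 1 else 2) / pi) * (indicator {0..a} x * cos (real k * x))" for x
    using assms by (auto simp: cos_system_def indicator_def)
  then show ?thesis
    by (simp add: integral_indicator_cos[OF assms(1)] real_sqrt_divide)
qed

section \<open>Parseval's identity for the step and its tail\<close>

text \<open>Up to the factor 2 / pi this is the squared coefficient of the step at frequency
  \<open>k + 1\<close>. The shift leaves out frequency 0, whose coefficient has another
  form.\<close>

definition sin_sq_term :: "nat \<Rightarrow> real \<Rightarrow> real" where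
  "sin_sq_term k a = (sin (real (Suc k) * a) / real (Suc k))\<^sup>2"

text \<open>The squared norm of the step is \<open>a\<close> and its squared constant coefficient is
  a^2 / pi; their difference a (pi - a) / pi is the first term on the right.\<close>

lemma cos_projection_step:
  assumes "0 \<le> a" "a \<le> pi"
  shows "(\<integral>x. (indicator {0..a} x -
        (\<Sum>k\<le>N. (\<integral>t. indicator {0..a} t * cos_system k t \<partial>lborel) * cos_system k x))\<^sup>2 \<partial>lborel) =
     2 / pi * (a * (pi - a) / 2 - (\<Sum>k<N. sin_sq_term k a))"
proof -
  have "bdd_supp {0..pi} (indicator {0..a})"
    using assms by (intro bdd_supp_indicator) auto
  from cosine.integral_diff_projection_square[OF _ this, of "{..N}"]
  have "(\<integral>x. (indicator {0..a} x -
        (\<Sum>k\<le>N. (\<integral>t. indicator {0..a} t * cos_system k t \<partial>lborel) * cos_system k x))\<^sup>2 \<partial>lborel) =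
     (\<integral>x. (indicator {0..a} x)\<^sup>2 \<partial>lborel) -
     (\<Sum>k\<le>N. (\<integral>t. indicator {0..a} t * cos_system k t \<partial>lborel)\<^sup>2)"
    by simp
  also have "(\<integral>x. (indicator {0..a} x :: real)\<^sup>2 \<partial>lborel) = a"
    using assms by (simp add: power2_eq_square flip: indicator_inter_arith)
  also have "(\<Sum>k\<le>N. (\<integral>t. indicator {0..a} t * cos_system k t \<partial>lborel)\<^sup>2) =
     a\<^sup>2 / pi + 2 / pi * (\<Sum>k<N. sin_sq_term k a)"
    \<comment> \<open>Splitting off the constant cosine leaves the frequencies 1, ...,
      \<open>N\<close>, which are the indices below \<open>N\<close> of
      \<open>sin_sq_term\<close>.\<close>
    unfolding sum.atMost_shift integral_step_mult_cos_system[OF assms]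
    by (simp add: power_divide power_mult_distrib sin_sq_term_def sum_distrib_left del: of_nat_Suc)
  finally show ?thesis
    by (simp add: field_simps power2_eq_square)
qed

lemma sum_sin_sq_le:
  assumes "0 \<le> a" "a \<le> pi"
  shows "(\<Sum>k<N. sin_sq_term k a) \<le> a * (pi - a) / 2"
proof -
  have "0 \<le> 2 / pi * (a * (pi - a) / 2 - (\<Sum>k<N. sin_sq_term k a))"
    unfolding cos_projection_step[OF assms, symmetric]
    by (rule Bochner_Integration.integral_nonneg) simp
  then show ?thesis
    using pi_gt_zero by (auto simp: zero_le_divide_iff)
qed

lemma sin_sq_term_le: "norm (sin_sq_term k a) \<le> 1 / (real k + 1)\<^sup>2"
proof -
  have "(sin (real (Suc k) * a))\<^sup>2 \<le> 1"
    by (simp add: abs_square_le_1)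
  then show ?thesis
    by (simp add: sin_sq_term_def power_divide divide_right_mono add.commute)
qed

lemma integral_sin_sq_term:
  "(\<integral>x. indicator {0..pi} x * sin_sq_term k x \<partial>lborel) = pi / 2 * (1 / (real k + 1)\<^sup>2)"
proof -
  have i: "integrable lborel (\<lambda>x. indicator {0..pi} x * cos (real_of_int m * x))" for m
    by (intro bdd_supp_integrable[of "{0..pi}"] bdd_supp_indicator_continuous) (auto intro!: continuous_intros)
  \<comment> \<open>From sin^2 u = (1 - cos (2 u)) / 2. The constant 1 is written as a cosine of
    frequency 0, so that \<open>integral_cos_multiple\<close> evaluates both terms.\<close>
  have "indicator {0..pi} x * sin_sq_term k x = 1 / (2 * (real k + 1)\<^sup>2) *
      (indicator {0..pi} x * cos (of_int 0 * x) -
       indicator {0..pi} x * cos (of_int (2 * int (Suc k)) * x))" for x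
  proof -
    have "cos (of_int (2 * int (Suc k)) * x) = 1 - 2 * (sin (real (Suc k) * x))\<^sup>2"
      using cos_double_sin[of "real (Suc k) * x"] by (simp add: mult_ac)
    then show ?thesis
      by (cases "x \<in> {0..pi}") (simp_all add: sin_sq_term_def power_divide field_simps)
  qed
  then have "(\<integral>x. indicator {0..pi} x * sin_sq_term k x \<partial>lborel) = 1 / (2 * (real k + 1)\<^sup>2) *
      ((\<integral>x. indicator {0..pi} x * cos (of_int 0 * x) \<partial>lborel) -
       (\<integral>x. indicator {0..pi} x * cos (of_int (2 * int (Suc k)) * x) \<partial>lborel))"
    by (simp only: integral_mult_right_zero Bochner_Integration.integral_diff[OF i i])
  then show ?thesis
    unfolding integral_cos_multiple by simp
qed

text \<open>
  Parseval's identity for the step, without completeness of the cosines: Bessel gives \<open>\<le>\<close>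
  between two continuous functions of \<open>a\<close>, and their integrals over \<open>[0, \<pi>]\<close> agree because
  \<open>\<Sum>1 / n\<^sup>2 = \<pi>\<^sup>2 / 6\<close>.
\<close>

lemma sin_sq_term_sums:
  assumes a: "0 \<le> a" "a \<le> pi"
  shows "(\<lambda>k. sin_sq_term k a) sums (a * (pi - a) / 2)"
proof -
  \<comment> \<open>The gap in Parseval's identity. It is continuous, since the series converges
    uniformly, and nonnegative by Bessel.\<close>
  define G where "G x = x * (pi - x) / 2 - (\<Sum>k. sin_sq_term k x)" for x
  have sq: "(\<lambda>n. 1 / (real n + 1)\<^sup>2) sums (pi\<^sup>2 / 6)"
    using inverse_squares_sums by (simp add: add_ac)
  have summable: "summable (\<lambda>k. sin_sq_term k x)" for x
    by (rule summable_comparison_test'[OF sums_summable[OF sq]]) (rule sin_sq_term_le)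
  have nonneg: "0 \<le> sin_sq_term k x" for k x
    by (simp add: sin_sq_term_def)
  have cont_term: "continuous_on X (sin_sq_term k)" for k X
    unfolding sin_sq_term_def by (intro continuous_intros) auto
  have "uniform_limit {0..pi} (\<lambda>n x. \<Sum>k<n. sin_sq_term k x) (\<lambda>x. \<Sum>k. sin_sq_term k x) sequentially"
    by (rule Weierstrass_m_test[OF sin_sq_term_le sums_summable[OF sq]])
  then have "continuous_on {0..pi} (\<lambda>x. \<Sum>k. sin_sq_term k x)"
    by (rule uniform_limit_theorem[rotated])
      (auto intro!: always_eventually continuous_on_sum cont_term)
  then have cont: "continuous_on {0..pi} G"
    unfolding G_def by (intro continuous_intros) auto
  have G_nonneg: "0 \<le> G x" if "x \<in> {0..pi}" for x
    unfolding G_def using suminf_le_const[OF summable sum_sin_sq_le, of x] that by simp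
  have int: "integrable lborel (\<lambda>x. indicator {0..pi} x * f x)" if "continuous_on {0..pi} f" for f :: "real \<Rightarrow> real"
    using that by (intro bdd_supp_integrable[of "{0..pi}"] bdd_supp_indicator_continuous) auto
  have int_quadratic: "(\<integral>x. indicator {0..pi} x * (x * (pi - x) / 2) \<partial>lborel) = pi ^ 3 / 12"
  proof -
    have "(\<integral>x. indicator {0..pi} x *\<^sub>R (x * (pi - x) / 2) \<partial>lborel) =
        (pi * pi\<^sup>2 / 4 - pi ^ 3 / 6) - (pi * 0\<^sup>2 / 4 - 0 ^ 3 / 6)"
      by (rule integral_FTC_atLeastAtMost[where F = "\<lambda>x. pi * x\<^sup>2 / 4 - x ^ 3 / 6"])
        (auto intro!: derivative_eq_intros continuous_intros simp: field_simps power2_eq_square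
          simp flip: has_real_derivative_iff_has_vector_derivative)
    then show ?thesis by (simp add: power2_eq_square power3_eq_cube)
  qed
  \<comment> \<open>Replacing the series in \<open>G\<close> by a partial sum only increases the
    integrand. Only finite sums are integrated, and the limit is taken afterwards in the resulting
    numbers.\<close>
  have "(\<integral>x. indicator {0..pi} x * G x \<partial>lborel) \<le> pi ^ 3 / 12 - pi / 2 * (\<Sum>k<N. 1 / (real k + 1)\<^sup>2)" for N
  proof -
    have "(\<integral>x. indicator {0..pi} x * G x \<partial>lborel) \<le>
        (\<integral>x. indicator {0..pi} x * (x * (pi - x) / 2) - (\<Sum>k<N. indicator {0..pi} x * sin_sq_term k x) \<partial>lborel)"
    proof (rule integral_mono)
      show "integrable lborel (\<lambda>x. indicator {0..pi} x * G x)"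
        by (intro int cont)
      show "integrable lborel (\<lambda>x. indicator {0..pi} x * (x * (pi - x) / 2) -
          (\<Sum>k<N. indicator {0..pi} x * sin_sq_term k x))"
        by (intro Bochner_Integration.integrable_diff Bochner_Integration.integrable_sum int cont_term continuous_intros) auto
      show "indicator {0..pi} x * G x \<le> indicator {0..pi} x * (x * (pi - x) / 2) -
          (\<Sum>k<N. indicator {0..pi} x * sin_sq_term k x)" for x
        using sum_le_suminf[OF summable[of x], of "{..<N}"] nonneg
        by (auto simp: G_def indicator_def)
    qed
    also have "\<dots> = (\<integral>x. indicator {0..pi} x * (x * (pi - x) / 2) \<partial>lborel) -
        (\<Sum>k<N. \<integral>x. indicator {0..pi} x * sin_sq_term k x \<partial>lborel)"
    proof -
      have "integrable lborel (\<lambda>x. indicator {0..pi} x * (x * (pi - x) / 2))"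
        by (intro int continuous_intros) simp
      moreover have "integrable lborel (\<lambda>x. \<Sum>k<N. indicator {0..pi} x * sin_sq_term k x)"
        by (intro Bochner_Integration.integrable_sum int cont_term)
      ultimately show ?thesis
        by (simp only: Bochner_Integration.integral_diff
            Bochner_Integration.integral_sum[OF int[OF cont_term]])
    qed
    finally show ?thesis
      by (simp only: int_quadratic integral_sin_sq_term sum_distrib_left)
  qed
  moreover have "(\<lambda>N. pi ^ 3 / 12 - pi / 2 * (\<Sum>k<N. 1 / (real k + 1)\<^sup>2)) \<longlonglongrightarrow> pi ^ 3 / 12 - pi / 2 * (pi\<^sup>2 / 6)"
    using sq unfolding sums_def by (intro tendsto_intros)
  ultimately have "(\<integral>x. indicator {0..pi} x * G x \<partial>lborel) \<le> pi ^ 3 / 12 - pi / 2 * (pi\<^sup>2 / 6)"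
    by (intro LIMSEQ_le_const) auto
  also have "\<dots> = 0"
    by (simp add: power2_eq_square power3_eq_cube)
  finally have 0: "(\<integral>x. indicator {0..pi} x * G x \<partial>lborel) = 0"
    using G_nonneg by (intro antisym Bochner_Integration.integral_nonneg) (auto simp: indicator_def)
  have "G a = 0"
    by (rule continuous_nonneg_integral_0[OF pi_gt_zero cont G_nonneg 0]) (use a in auto)
  then show ?thesis
    using summable_sums[OF summable[of a]] by (simp add: G_def)
qed

text \<open>By Parseval the left side is the tail of the series from index \<open>N\<close>; it is
  compared termwise with a telescoping series.\<close>

lemma sin_sq_tail_le:
  assumes "0 \<le> a" "a \<le> pi"
  shows "a * (pi - a) / 2 - (\<Sum>k<N. sin_sq_term k a) \<le> 2 / (real N + 1)"
proof -
  define f where "f k = 2 / (real (k + N) + 1)" for k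
  have "f \<longlonglongrightarrow> 0"
  proof -
    have "(\<lambda>k. 2 * inverse (real (Suc (k + N)))) \<longlonglongrightarrow> 2 * 0"
      by (intro LIMSEQ_ignore_initial_segment[where f = "\<lambda>k. 2 * inverse (real (Suc k))"]
          tendsto_mult tendsto_const LIMSEQ_inverse_real_of_nat)
    moreover have "f = (\<lambda>k. 2 * inverse (real (Suc (k + N))))"
      by (simp add: f_def fun_eq_iff divide_inverse add_ac)
    ultimately show ?thesis by simp
  qed
  then have "(\<lambda>k. f k - f (Suc k)) sums (f 0 - 0)"
    by (rule telescope_sums')
  moreover have "(\<lambda>k. sin_sq_term (k + N) a) sums (a * (pi - a) / 2 - (\<Sum>k<N. sin_sq_term k a))"
    by (rule sums_split_initial_segment[OF sin_sq_term_sums[OF assms]])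
  moreover have "sin_sq_term (k + N) a \<le> f k - f (Suc k)" for k
  proof -
    define m where "m = real (k + N) + 1"
    have m: "m \<ge> 1" by (simp add: m_def)
    have "sin_sq_term (k + N) a \<le> 1 / m\<^sup>2"
      using sin_sq_term_le[of "k + N" a] by (simp add: m_def)
    \<comment> \<open>The right side is 2 / (m (m + 1)). The factor 2 makes the comparison valid
      from m = 1 on, so that \<open>N = 0\<close> is included.\<close>
    also have "\<dots> \<le> 2 / m - 2 / (m + 1)"
    proof -
      have "2 / m - 2 / (m + 1) - 1 / m\<^sup>2 = (m - 1) / (m\<^sup>2 * (m + 1))"
        using m by (simp add: divide_simps) (simp add: power2_eq_square algebra_simps)
      moreover have "0 \<le> (m - 1) / (m\<^sup>2 * (m + 1))"
        using m by (intro divide_nonneg_nonneg mult_nonneg_nonneg) auto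
      ultimately show ?thesis
        by linarith
    qed
    also have "\<dots> = f k - f (Suc k)"
      by (simp add: f_def m_def add_ac)
    finally show ?thesis .
  qed
  ultimately show ?thesis
    using sums_le[of "\<lambda>k. sin_sq_term (k + N) a" "\<lambda>k. f k - f (Suc k)"] by (simp add: f_def)
qed

lemma step_cos_approx:
  assumes "0 \<le> a" "a \<le> pi"
  obtains c where "(\<integral>x. indicator {0..pi} x * (indicator {0..a} x - (\<Sum>k\<le>N. c k * cos (real k * x)))\<^sup>2 \<partial>lborel)
     \<le> 2 / (real N + 1)"
proof -
  define c where "c k = (\<integral>t. indicator {0..a} t * cos_system k t \<partial>lborel) * sqrt ((if k = 0 then 1 else 2) / pi)" for k
  have "indicator {0..pi} x * (indicator {0..a} x - (\<Sum>k\<le>N. c k * cos (real k * x)))\<^sup>2 =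
     (indicator {0..a} x -
        (\<Sum>k\<le>N. (\<integral>t. indicator {0..a} t * cos_system k t \<partial>lborel) * cos_system k x))\<^sup>2" for x
    using assms by (cases "x \<in> {0..pi}") (auto simp: c_def cos_system_def mult.assoc)
  then have "(\<integral>x. indicator {0..pi} x * (indicator {0..a} x - (\<Sum>k\<le>N. c k * cos (real k * x)))\<^sup>2 \<partial>lborel) =
      2 / pi * (a * (pi - a) / 2 - (\<Sum>k<N. sin_sq_term k a))"
    by (simp only: cos_projection_step[OF assms])
  \<comment> \<open>The factor 2 / pi is at most 1.\<close>
  also have "\<dots> \<le> 1 * (2 / (real N + 1))"
    using sin_sq_tail_le[OF assms] sum_sin_sq_le[OF assms] pi_gt3 by (intro mult_mono) auto
  finally show ?thesis
    by (intro that[of c]) simp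
qed

section \<open>Chebyshev polynomials and polynomial approximation of a step\<close>

text \<open>These are the Chebyshev polynomials, built by the recurrence T_(k+2) = 2 x T_(k+1) -
  T_k.\<close>

lemma cos_multiple_poly:
  "\<exists>p :: real poly. degree p \<le> k \<and> (\<forall>x. poly p (cos x) = cos (real k * x))"
proof (induction k rule: induct_nat_012)
  case 0
  show ?case by (intro exI[of _ 1]) auto
next
  case 1
  show ?case by (intro exI[of _ "[:0, 1:]"]) auto
next
  case (ge2 k)
  obtain p q :: "real poly" where p: "degree p \<le> k" "\<And>x. poly p (cos x) = cos (real k * x)"
    and q: "degree q \<le> Suc k" "\<And>x. poly q (cos x) = cos (real (Suc k) * x)"
    using ge2 by blast
  show ?case
  proof (intro exI conjI allI)
    have "degree ([:0, 2:] * q) \<le> Suc (Suc k)"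
      using degree_mult_le[of "[:0, 2:]" q] q(1) by simp
    then show "degree ([:0, 2:] * q - p) \<le> Suc (Suc k)"
      using p(1) by (intro degree_diff_le) auto
    show "poly ([:0, 2:] * q - p) (cos x) = cos (real (Suc (Suc k)) * x)" for x
    proof -
      have "cos (real (Suc (Suc k)) * x) + cos (real k * x) = 2 * cos (real (Suc k) * x) * cos x"
        using cos_add[of "real (Suc k) * x" x] cos_diff[of "real (Suc k) * x" x]
        by (simp add: algebra_simps)
      then show ?thesis
        using p(2)[of x] q(2)[of x] by (simp add: algebra_simps)
    qed
  qed
qed

text \<open>The substitution \<open>x = (1 - cos \<theta>) / 2\<close> turns cosine sums into polynomials.\<close>

lemma step_poly_approx:
  assumes t: "0 \<le> t" "t \<le> 1"
  obtains p :: "real poly" where "degree p \<le> N"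
    "(\<integral>x. indicator {0..1} x * (indicator {0..t} x - poly p x)\<^sup>2 \<partial>lborel) \<le> 2 / (real N + 1)"
proof -
  \<comment> \<open>Chosen so that (1 - cos a) / 2 = t: the jump at \<open>t\<close> corresponds to
    a jump at the angle \<open>a\<close>.\<close>
  define a where "a = arccos (1 - 2 * t)"
  have a: "0 \<le> a" "a \<le> pi" and cos_a: "cos a = 1 - 2 * t"
    unfolding a_def using t by (auto intro: arccos_lbound arccos_ubound)
  obtain c where c: "(\<integral>x. indicator {0..pi} x * (indicator {0..a} x - (\<Sum>k\<le>N. c k * cos (real k * x)))\<^sup>2 \<partial>lborel)
     \<le> 2 / (real N + 1)" using step_cos_approx[OF a] by blast
  obtain T :: "nat \<Rightarrow> real poly" where T: "\<And>k. degree (T k) \<le> k" "\<And>k x. poly (T k) (cos x) = cos (real k * x)"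
    using cos_multiple_poly by metis
  \<comment> \<open>The inner polynomial 1 - 2 x recovers cos \<theta> from x = (1 - cos \<theta>) /
    2; being linear, it does not raise the degree.\<close>
  define p where "p = pcompose (\<Sum>k\<le>N. smult (c k) (T k)) [:1, -2:]"
  define g where "g x = (1 - cos x) / 2" for x :: real
  define f where "f x = (indicator {0..t} x - poly p x)\<^sup>2" for x
  have "degree (\<Sum>k\<le>N. smult (c k) (T k)) \<le> N"
    by (intro degree_sum_le) (auto intro: order_trans[OF degree_smult_le] order_trans[OF T(1)])
  then have deg: "degree p \<le> N"
    unfolding p_def using degree_pcompose_le[of "\<Sum>k\<le>N. smult (c k) (T k)" "[:1, -2:]"] by simp
  have pg: "poly p (g x) = (\<Sum>k\<le>N. c k * cos (real k * x))" for x
  proof -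
    have "poly [:1, -2:] (g x) = cos x"
      by (simp add: g_def field_simps)
    then show ?thesis
      by (simp only: p_def poly_pcompose poly_sum poly_smult T(2))
  qed
  have ind: "indicator {0..t} (g x) = (indicator {0..a} x :: real)" if "x \<in> {0..pi}" for x
    using cos_mono_le_eq[of a x] that a by (auto simp: indicator_def g_def cos_a)
  have g: "g 0 = 0" "g pi = 1"
    by (auto simp: g_def)
  have fb: "bdd_supp {0..1} (\<lambda>x. indicator {0..1} x * f x)"
  proof -
    have "bdd_supp {0..1} (\<lambda>x. (indicator {0..t} x - indicator {0..1} x * poly p x)\<^sup>2)"
      using t by (intro bdd_supp_power2 bdd_supp_diff bdd_supp_indicator bdd_supp_indicator_continuous)
        (auto intro!: continuous_intros)
    moreover have "(indicator {0..t} x - indicator {0..1} x * poly p x)\<^sup>2 = indicator {0..1} x * f x" for x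
      using t by (auto simp: f_def indicator_def)
    ultimately show ?thesis by simp
  qed
  \<comment> \<open>The integrand may jump at \<open>t\<close>, so the substitution rule for
    integrable functions is used; its monotonicity condition is that sin is nonnegative on
    [0, pi].\<close>
  have sub: "set_integrable lborel {0..pi} (\<lambda>x. f (g x) * (sin x / 2))"
    "(\<integral>x. f x * indicator {g 0..g pi} x \<partial>lborel) =
      (\<integral>x. f (g x) * (sin x / 2) * indicator {0..pi} x \<partial>lborel)"
  proof -
    have 1: "set_integrable lborel {g 0..g pi} f"
      using bdd_supp_integrable[OF _ fb] by (simp add: set_integrable_def g)
    have 2: "\<And>x. x \<in> {0..pi} \<Longrightarrow> (g has_real_derivative sin x / 2) (at x)"
      unfolding g_def by (auto intro!: derivative_eq_intros)
    have 3: "continuous_on {0..pi} (\<lambda>x. sin x / 2)" "\<And>x. x \<in> {0..pi} \<Longrightarrow> 0 \<le> sin x / 2"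
      by (auto intro!: continuous_intros sin_ge_zero)
    show "set_integrable lborel {0..pi} (\<lambda>x. f (g x) * (sin x / 2))"
      "(\<integral>x. f x * indicator {g 0..g pi} x \<partial>lborel) =
      (\<integral>x. f (g x) * (sin x / 2) * indicator {0..pi} x \<partial>lborel)"
      using integral_substitution[OF 1 2 3] by auto
  qed
  have "(\<integral>x. indicator {0..1} x * f x \<partial>lborel) = (\<integral>x. f (g x) * (sin x / 2) * indicator {0..pi} x \<partial>lborel)"
    using sub(2) by (simp add: g mult.commute)
  also have "\<dots> \<le> (\<integral>x. indicator {0..pi} x * (indicator {0..a} x - (\<Sum>k\<le>N. c k * cos (real k * x)))\<^sup>2 \<partial>lborel)"
  proof (rule integral_mono)
    show "integrable lborel (\<lambda>x. f (g x) * (sin x / 2) * indicator {0..pi} x)"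
      using sub(1) by (simp add: set_integrable_def mult_ac)
    have "bdd_supp {0..pi} (\<lambda>x. (indicator {0..a} x - indicator {0..pi} x * (\<Sum>k\<le>N. c k * cos (real k * x)))\<^sup>2)"
      using a by (intro bdd_supp_power2 bdd_supp_diff bdd_supp_indicator bdd_supp_indicator_continuous)
        (auto intro!: continuous_intros)
    moreover have "(indicator {0..a} x - indicator {0..pi} x * (\<Sum>k\<le>N. c k * cos (real k * x)))\<^sup>2 =
        indicator {0..pi} x * (indicator {0..a} x - (\<Sum>k\<le>N. c k * cos (real k * x)))\<^sup>2" for x
      using a by (auto simp: indicator_def)
    ultimately show "integrable lborel (\<lambda>x. indicator {0..pi} x * (indicator {0..a} x - (\<Sum>k\<le>N. c k * cos (real k * x)))\<^sup>2)"
      using bdd_supp_integrable[of "{0..pi}"] by simp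
    show "f (g x) * (sin x / 2) * indicator {0..pi} x \<le>
        indicator {0..pi} x * (indicator {0..a} x - (\<Sum>k\<le>N. c k * cos (real k * x)))\<^sup>2" for x
    proof (cases "x \<in> {0..pi}")
      case True
      \<comment> \<open>The density sin x / 2 of the substitution is simply bounded by 1, leaving
        the unweighted error of the cosine sum.\<close>
      have "sin x / 2 \<le> 1"
        using sin_le_one[of x] by linarith
      then have "f (g x) * (sin x / 2) \<le> f (g x) * 1"
        by (intro mult_left_mono) (auto simp: f_def)
      then show ?thesis
        using True by (simp add: f_def pg ind)
    qed simp
  qed
  also note c
  finally show ?thesis
    using deg by (intro that[of p]) (auto simp: f_def)
qed

subsection \<open>Legendre polynomials\<close>

lemma integrable_unit_poly: "integrable lborel (\<lambda>x. indicator {0..1} x * poly p x :: real)"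
  by (intro bdd_supp_integrable[of "{0..1}"] bdd_supp_indicator_continuous) (auto intro!: continuous_intros)

lemma unit_inner_poly:
  "unit_inner (poly p) (poly q) = (\<integral>x. indicator {0..1} x * poly (p * q) x \<partial>lborel)"
  by (simp add: unit_inner_def set_lebesgue_integral_def)

lemma unit_inner_poly_diff:
  "unit_inner (poly (p - q)) (poly r) = unit_inner (poly p) (poly r) - unit_inner (poly q) (poly r)"
  unfolding unit_inner_poly
  by (subst Bochner_Integration.integral_diff[symmetric, OF integrable_unit_poly integrable_unit_poly])
    (simp add: algebra_simps)

lemma unit_inner_poly_smult:
  "unit_inner (poly (smult c p)) (poly r) = c * unit_inner (poly p) (poly r)"
  unfolding unit_inner_poly
  by (subst integral_mult_right_zero[symmetric]) (simp add: algebra_simps)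

lemma unit_inner_poly_sum:
  "unit_inner (poly (\<Sum>i\<in>I. p i)) (poly r) = (\<Sum>i\<in>I. unit_inner (poly (p i)) (poly r))"
  unfolding unit_inner_poly
  by (subst Bochner_Integration.integral_sum[symmetric, OF integrable_unit_poly])
    (simp add: poly_sum sum_distrib_left sum_distrib_right)

lemma unit_inner_commute: "unit_inner f g = unit_inner g f"
  by (simp add: unit_inner_def mult.commute)

text \<open>Otherwise the polynomial would vanish on all of [0, 1] and have infinitely many roots.
  This makes the normalization in Gram-Schmidt a division by a positive number.\<close>

lemma unit_inner_poly_pos:
  assumes "p \<noteq> 0"
  shows "0 < unit_inner (poly p) (poly p)"
proof (rule ccontr)
  assume "\<not> ?thesis"
  moreover have "0 \<le> unit_inner (poly p) (poly p)"
    unfolding unit_inner_poly by (intro Bochner_Integration.integral_nonneg) (simp add: indicator_def)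
  ultimately have 0: "(\<integral>x. indicator {0..1} x * poly (p * p) x \<partial>lborel) = 0"
    unfolding unit_inner_poly by linarith
  have "poly (p * p) x = 0" if "x \<in> {0..1}" for x
    by (rule continuous_nonneg_integral_0[OF _ _ _ 0 that]) (auto intro!: continuous_intros)
  then have "{0..1} \<subseteq> {x. poly p x = 0}"
    by auto
  then have "finite {0..1::real}"
    using poly_roots_finite[OF assms] finite_subset by blast
  then show False
    using infinite_Icc[of 0 "1::real"] by simp
qed

text \<open>Polynomial form, exact degree and orthonormality are proved in one strong induction: the
  step at \<open>n\<close> needs all of the earlier functions to be orthonormal polynomials of their
  exact degrees.\<close>

lemma shifted_legendre_Gram_Schmidt:
  "\<exists>q. degree q = n \<and> q \<noteq> 0 \<and> shifted_legendre n = poly q \<and>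
     (\<forall>i<n. unit_inner (shifted_legendre n) (shifted_legendre i) = 0) \<and>
     unit_inner (shifted_legendre n) (shifted_legendre n) = 1"
proof (induction n rule: less_induct)
  case (less n)
  obtain Q where Q: "\<And>i. i < n \<Longrightarrow> degree (Q i) = i" "\<And>i. i < n \<Longrightarrow> shifted_legendre i = poly (Q i)"
    using less by metis
  have orth: "unit_inner (poly (Q i)) (poly (Q j)) = (if i = j then 1 else 0)" if "i < n" "j < n" for i j
    using less[OF that(1)] less[OF that(2)] Q(2)[OF that(1)] Q(2)[OF that(2)]
    by (metis unit_inner_commute linorder_neqE_nat)
  define c where "c i = unit_inner (\<lambda>t. t ^ n) (shifted_legendre i)" for i
  define p where "p = monom 1 n - (\<Sum>i<n. smult (c i) (Q i))"
  \<comment> \<open>The subtracted projections have degree below \<open>n\<close>, so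
    \<open>p\<close> is monic of degree \<open>n\<close> and in particular nonzero.\<close>
  have "coeff (\<Sum>i<n. smult (c i) (Q i)) n = 0"
    unfolding coeff_sum by (intro sum.neutral) (auto simp: Q(1) intro!: coeff_eq_0)
  then have coeff_n: "coeff p n = 1"
    by (simp add: p_def)
  have "degree p \<le> n"
    unfolding p_def using Q(1)
    by (intro degree_diff_le degree_sum_le) (auto simp: degree_monom_eq intro: order_trans[OF degree_smult_le])
  with coeff_n have deg: "degree p = n"
    by (metis le_degree le_antisym zero_neq_one)
  have p0: "p \<noteq> 0"
    using coeff_n by auto
  define s where "s = unit_inner (poly p) (poly p)"
  have s: "s > 0"
    unfolding s_def by (rule unit_inner_poly_pos[OF p0])
  have poly_p: "poly p = (\<lambda>x. x ^ n - (\<Sum>i<n. unit_inner (\<lambda>t. t ^ n) (shifted_legendre i) * shifted_legendre i x))"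
    by (auto simp: p_def fun_eq_iff poly_monom poly_sum c_def Q(2))
  have sl: "shifted_legendre n = poly (smult (1 / sqrt s) p)"
    by (subst shifted_legendre.simps) (simp add: poly_p[symmetric] s_def Let_def fun_eq_iff)
  have "unit_inner (poly p) (poly (Q j)) = 0" if "j < n" for j
  proof -
    have "poly (monom 1 n) = (\<lambda>t::real. t ^ n)"
      by (simp add: fun_eq_iff poly_monom)
    have "unit_inner (poly p) (poly (Q j)) = c j - (\<Sum>i<n. c i * (if i = j then 1 else 0))"
      using that \<open>poly (monom 1 n) = _\<close>
      by (simp add: p_def unit_inner_poly_diff unit_inner_poly_sum unit_inner_poly_smult orth
          c_def Q(2))
    then show ?thesis
      using that by (simp add: if_distrib cong: if_cong)
  qed
  then have "\<forall>i<n. unit_inner (shifted_legendre n) (shifted_legendre i) = 0"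
    by (simp add: sl Q(2) unit_inner_poly_smult del: poly_smult)
  moreover have "unit_inner (shifted_legendre n) (shifted_legendre n) = 1"
  proof -
    have "unit_inner (shifted_legendre n) (shifted_legendre n) = 1 / sqrt s * (1 / sqrt s * s)"
      unfolding sl unit_inner_poly_smult
      by (subst unit_inner_commute) (simp only: unit_inner_poly_smult s_def)
    then show ?thesis using s by simp
  qed
  moreover have "degree (smult (1 / sqrt s) p) = n" "smult (1 / sqrt s) p \<noteq> 0"
    using s deg p0 by auto
  ultimately show ?case
    using sl by blast
qed

lemma unit_inner_shifted_legendre:
  "unit_inner (shifted_legendre i) (shifted_legendre j) = (if i = j then 1 else 0)"
proof (cases i j rule: linorder_cases)
  case less
  then show ?thesis
    using shifted_legendre_Gram_Schmidt[of j] by (auto simp: unit_inner_commute[of "shifted_legendre i"])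
qed (use shifted_legendre_Gram_Schmidt[of i] in auto)

lemma continuous_on_shifted_legendre: "continuous_on S (shifted_legendre n)"
  using shifted_legendre_Gram_Schmidt[of n] by (auto intro!: continuous_intros)

text \<open>The induction removes the coefficient at \<open>n\<close> by a multiple of the Legendre
  polynomial of exact degree \<open>n\<close>. A hypothesis on coefficients, unlike a strict degree
  bound, lets \<open>n = 0\<close> describe the zero polynomial.\<close>

lemma poly_shifted_legendre_expansion:
  assumes "\<And>k. k \<ge> n \<Longrightarrow> coeff p k = 0"
  shows "\<exists>b. \<forall>x. poly p x = (\<Sum>i<n. b i * shifted_legendre i x)"
  using assms
proof (induction n arbitrary: p)
  case 0
  then have "p = 0" by (simp add: poly_eq_iff)
  then show ?case by simp
next
  case (Suc n)
  obtain q where q: "degree q = n" "q \<noteq> 0" "shifted_legendre n = poly q"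
    using shifted_legendre_Gram_Schmidt by blast
  define c where "c = coeff p n / lead_coeff q"
  have "coeff (p - smult c q) k = 0" if "k \<ge> n" for k
  proof (cases "k = n")
    case True
    moreover have "coeff q n \<noteq> 0" using q by auto
    ultimately show ?thesis by (simp add: c_def q(1))
  next
    case False
    with that q Suc.prems[of k] show ?thesis by (simp add: coeff_eq_0)
  qed
  from Suc.IH[OF this] obtain b where
    b: "\<And>x. poly p x - c * poly q x = (\<Sum>i<n. b i * shifted_legendre i x)"
    by auto
  have "poly p x = (\<Sum>i<Suc n. (b(n := c)) i * shifted_legendre i x)" for x
    using b[of x] by (simp add: q(3))
  then show ?case by blast
qed

text \<open>\<open>shifted_legendre\<close> is a polynomial on the whole line; the cutoff makes it
  fit \<open>orthonormal_system\<close>.\<close>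

definition unit_legendre :: "nat \<Rightarrow> real \<Rightarrow> real" where
  "unit_legendre i x = indicator {0..1} x * shifted_legendre i x"

interpretation legendre: orthonormal_system "{0..1}" unit_legendre
proof
  show "bdd_supp {0..1} (unit_legendre i)" for i
    unfolding unit_legendre_def by (intro bdd_supp_indicator_continuous continuous_on_shifted_legendre) simp
  have "unit_legendre i x * unit_legendre j x =
      indicator {0..1} x *\<^sub>R (shifted_legendre i x * shifted_legendre j x)" for i j x
    by (simp add: unit_legendre_def indicator_def)
  then show "(\<integral>x. unit_legendre i x * unit_legendre j x \<partial>lborel) = (if i = j then 1 else 0)" for i j
    using unit_inner_shifted_legendre[of i j] by (simp add: unit_inner_def set_lebesgue_integral_def)
qed simp

subsection \<open>Sections of convex sets\<close>

lemma bdd_supp_step_minus_poly: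
  assumes "S \<in> sets borel"
  shows "bdd_supp {0..1} (\<lambda>x. indicator {0..1} x * (indicator S x - poly p x) :: real)"
proof -
  have "bdd_supp {0..1} (\<lambda>x. indicator (S \<inter> {0..1}) x - indicator {0..1} x * poly p x :: real)"
    using assms by (intro bdd_supp_diff bdd_supp_indicator bdd_supp_indicator_continuous)
      (auto intro!: continuous_intros)
  then show ?thesis
    by (simp add: right_diff_distrib indicator_inter_arith mult.commute)
qed

lemma integrable_indicator_minus_poly_square:
  assumes "S \<in> sets borel"
  shows "integrable lborel (\<lambda>x. indicator {0..1} x * (indicator S x - poly p x)\<^sup>2 :: real)"
proof -
  have "integrable lborel (\<lambda>x. (indicator {0..1} x * (indicator S x - poly p x))\<^sup>2 :: real)"
    by (rule bdd_supp_integrable[OF compact_Icc bdd_supp_power2[OF bdd_supp_step_minus_poly[OF assms]]])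
  moreover have "(indicator {0..1} x * (indicator S x - poly p x))\<^sup>2 =
      indicator {0..1} x * (indicator S x - poly p x)\<^sup>2" for x
    by (simp add: indicator_def)
  ultimately show ?thesis by simp
qed

lemma square_diff_le: "(u - v)\<^sup>2 \<le> 2 * u\<^sup>2 + 2 * (v::real)\<^sup>2"
  using zero_le_power2[of "u + v"] by (simp add: power2_eq_square algebra_simps)

text \<open>A nonempty \<open>S\<close> is an interval [a, b], whose indicator is the difference of
  the steps at \<open>b\<close> and \<open>a\<close> outside the point \<open>a\<close>. The
  constant is 8 = 2 * 2 + 2 * 2, by \<open>square_diff_le\<close>.\<close>

lemma compact_convex_poly_approx:
  assumes S: "compact S" "convex S" "S \<subseteq> {0..1}"
  obtains p :: "real poly" where "degree p \<le> N"
    "(\<integral>x. indicator {0..1} x * (indicator S x - poly p x)\<^sup>2 \<partial>lborel) \<le> 8 / (real N + 1)"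
proof (cases "S = {}")
  case True
  then show ?thesis by (intro that[of 0]) auto
next
  case False
  obtain a b where ab: "S = {a..b}"
    using S convex_connected connected_compact_interval_1 by metis
  with False S(3) have "a \<le> b" "0 \<le> a" "b \<le> 1" by auto
  obtain p where p: "degree p \<le> N"
    "(\<integral>x. indicator {0..1} x * (indicator {0..a} x - poly p x)\<^sup>2 \<partial>lborel) \<le> 2 / (real N + 1)"
    by (rule step_poly_approx[of a N]) (use \<open>a \<le> b\<close> \<open>0 \<le> a\<close> \<open>b \<le> 1\<close> in auto)
  obtain q where q: "degree q \<le> N"
    "(\<integral>x. indicator {0..1} x * (indicator {0..b} x - poly q x)\<^sup>2 \<partial>lborel) \<le> 2 / (real N + 1)"
    by (rule step_poly_approx[of b N]) (use \<open>a \<le> b\<close> \<open>0 \<le> a\<close> \<open>b \<le> 1\<close> in auto)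
  have int: "integrable lborel (\<lambda>x. indicator {0..1} x * (indicator {u..v} x - poly r x)\<^sup>2)" for r and u v :: real
    by (intro integrable_indicator_minus_poly_square) simp
  have "(\<integral>x. indicator {0..1} x * (indicator S x - poly (q - p) x)\<^sup>2 \<partial>lborel) \<le>
      (\<integral>x. 2 * (indicator {0..1} x * (indicator {0..b} x - poly q x)\<^sup>2) +
        2 * (indicator {0..1} x * (indicator {0..a} x - poly p x)\<^sup>2) \<partial>lborel)"
  \<comment> \<open>The decomposition into steps fails at the single point \<open>a\<close>, where
    both steps equal 1; hence a comparison almost everywhere.\<close>
  proof (rule integral_mono_AE)
    show "AE x in lborel. indicator {0..1} x * (indicator S x - poly (q - p) x)\<^sup>2 \<le>
        2 * (indicator {0..1} x * (indicator {0..b} x - poly q x)\<^sup>2) +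
        2 * (indicator {0..1} x * (indicator {0..a} x - poly p x)\<^sup>2)"
      using AE_lborel_singleton[of a]
    proof eventually_elim
      case (elim x)
      then have "indicator S x - poly (q - p) x = (indicator {0..b} x - poly q x) - (indicator {0..a} x - poly p x)"
        if "x \<in> {0..1}"
        using that \<open>a \<le> b\<close> \<open>0 \<le> a\<close> by (auto simp: ab indicator_def)
      then show ?case
        using square_diff_le[of "indicator {0..b} x - poly q x" "indicator {0..a} x - poly p x"]
        by (cases "x \<in> {0..1}") (simp_all del: poly_diff)
    qed
  qed (auto intro!: int Bochner_Integration.integrable_add integrable_mult_right simp: ab simp del: poly_diff)
  also have "\<dots> \<le> 2 * (2 / (real N + 1)) + 2 * (2 / (real N + 1))"
    using p q int[of 0 b q] int[of 0 a p] by simp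
  finally show ?thesis
    using p q by (intro that[of "q - p"]) (auto intro: degree_diff_le)
qed

text \<open>The difference of the approximants of \<open>S\<close> and \<open>T\<close> is a
  combination of the first \<open>N + 1\<close> Legendre polynomials and serves as competitor in
  \<open>projection_defect_le\<close>. The constant is 32 = 2 * 8 + 2 * 8.\<close>

lemma indicator_diff_Legendre_defect:
  assumes S: "compact S" "convex S" "S \<subseteq> {0..1}" and T: "compact T" "convex T" "T \<subseteq> {0..1}"
  shows "(\<integral>x. (indicator S x - indicator T x)\<^sup>2 \<partial>lborel) \<le>
    (\<Sum>i\<le>N. (\<integral>x. (indicator S x - indicator T x) * unit_legendre i x \<partial>lborel)\<^sup>2) + 32 / (real N + 1)"
proof -
  obtain p where p: "degree p \<le> N"
    "(\<integral>x. indicator {0..1} x * (indicator S x - poly p x)\<^sup>2 \<partial>lborel) \<le> 8 / (real N + 1)"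
    using compact_convex_poly_approx[OF S] by blast
  obtain q where q: "degree q \<le> N"
    "(\<integral>x. indicator {0..1} x * (indicator T x - poly q x)\<^sup>2 \<partial>lborel) \<le> 8 / (real N + 1)"
    using compact_convex_poly_approx[OF T] by blast
  have sets: "S \<in> sets borel" "T \<in> sets borel"
    using S T by (auto intro: borel_compact)
  have bdd: "bdd_supp {0..1} (\<lambda>x. indicator S x - indicator T x :: real)"
    using S T sets by (intro bdd_supp_diff bdd_supp_indicator)
  have "degree (p - q) < Suc N"
    using p q by (simp add: less_Suc_eq_le degree_diff_le)
  then obtain b where b: "\<And>x. poly p x - poly q x = (\<Sum>i\<le>N. b i * shifted_legendre i x)"
    using poly_shifted_legendre_expansion[of "Suc N" "p - q"]
    by (auto simp: coeff_eq_0 lessThan_Suc_atMost simp del: coeff_diff)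
  have "(\<integral>x. (indicator S x - indicator T x)\<^sup>2 \<partial>lborel) -
      (\<Sum>i\<le>N. (\<integral>x. (indicator S x - indicator T x) * unit_legendre i x \<partial>lborel)\<^sup>2) \<le>
      (\<integral>x. (indicator S x - indicator T x - (\<Sum>i\<le>N. b i * unit_legendre i x))\<^sup>2 \<partial>lborel)"
    by (rule legendre.projection_defect_le[OF _ bdd]) simp
  also have "\<dots> \<le> (\<integral>x. 2 * (indicator {0..1} x * (indicator S x - poly p x)\<^sup>2) +
        2 * (indicator {0..1} x * (indicator T x - poly q x)\<^sup>2) \<partial>lborel)"
  proof (rule integral_mono)
    show "integrable lborel (\<lambda>x. (indicator S x - indicator T x - (\<Sum>i\<le>N. b i * unit_legendre i x))\<^sup>2)"
      by (intro bdd_supp_integrable[of "{0..1}"] bdd_supp_power2 bdd_supp_diff[OF bdd] bdd_supp_sum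
          bdd_supp_cmult legendre.bdd) simp
    show "(indicator S x - indicator T x - (\<Sum>i\<le>N. b i * unit_legendre i x))\<^sup>2 \<le>
        2 * (indicator {0..1} x * (indicator S x - poly p x)\<^sup>2) +
        2 * (indicator {0..1} x * (indicator T x - poly q x)\<^sup>2)" for x
    proof (cases "x \<in> {0..1}")
      case True
      have "indicator S x - indicator T x - (\<Sum>i\<le>N. b i * unit_legendre i x) =
          (indicator S x - poly p x) - (indicator T x - poly q x)"
        using True b[of x] by (simp add: unit_legendre_def)
      then show ?thesis
        using square_diff_le[of "indicator S x - poly p x" "indicator T x - poly q x"] True
        by (simp only: indicator_simps mult_1)
    next
      case False
      then have "x \<notin> S" "x \<notin> T" using S T by auto
      with False show ?thesis by (simp add: unit_legendre_def)
    qed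
  qed (auto intro!: integrable_indicator_minus_poly_square sets Bochner_Integration.integrable_add integrable_mult_right)
  also have "\<dots> \<le> 2 * (8 / (real N + 1)) + 2 * (8 / (real N + 1))"
    using p q integrable_indicator_minus_poly_square[OF sets(1), of p]
      integrable_indicator_minus_poly_square[OF sets(2), of q] by simp
  finally show ?thesis by simp
qed

lemma compact_convex_sections:
  fixes K :: "(real \<times> real) set"
  assumes "compact K" "convex K" "K \<subseteq> {0..1} \<times> {0..1}"
  shows "compact {x. (x, y) \<in> K}" "convex {x. (x, y) \<in> K}" "{x. (x, y) \<in> K} \<subseteq> {0..1}"
    and "compact {y. (x, y) \<in> K}" "convex {y. (x, y) \<in> K}" "{y. (x, y) \<in> K} \<subseteq> {0..1}"
proof -
  have closed: "closed K"
    using assms(1) by (rule compact_imp_closed)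
  show sub: "{x. (x, y) \<in> K} \<subseteq> {0..1}" "{y. (x, y) \<in> K} \<subseteq> {0..1}"
    using assms(3) by auto
  have "closed ((\<lambda>x. (x, y)) -` K)" "closed (Pair x -` K)"
    by (intro continuous_closed_vimage closed; auto intro!: continuous_intros)+
  then show "compact {x. (x, y) \<in> K}" "compact {y. (x, y) \<in> K}"
    using sub bounded_subset[OF bounded_closed_interval] unfolding compact_eq_bounded_closed vimage_def
    by blast+
  have mem: "(u * a + v * a', u * b + v * b') \<in> K"
    if "(a, b) \<in> K" "(a', b') \<in> K" "0 \<le> u" "0 \<le> v" "u + v = 1" for a b a' b' u v
    using convexD[OF assms(2) that] by simp
  show "convex {x. (x, y) \<in> K}"
  proof (rule convexI)
    fix a a' u v :: real
    assume *: "a \<in> {x. (x, y) \<in> K}" "a' \<in> {x. (x, y) \<in> K}" "0 \<le> u" "0 \<le> v" "u + v = 1"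
    have "u * y + v * y = y"
      using *(5) by (simp flip: distrib_right)
    then show "u *\<^sub>R a + v *\<^sub>R a' \<in> {x. (x, y) \<in> K}"
      using mem[of a y a' y u v] * by simp
  qed
  show "convex {y. (x, y) \<in> K}"
  proof (rule convexI)
    fix a a' u v :: real
    assume *: "a \<in> {y. (x, y) \<in> K}" "a' \<in> {y. (x, y) \<in> K}" "0 \<le> u" "0 \<le> v" "u + v = 1"
    have "u * x + v * x = x"
      using *(5) by (simp flip: distrib_right)
    then show "u *\<^sub>R a + v *\<^sub>R a' \<in> {y. (x, y) \<in> K}"
      using mem[of x a x a' u v] * by simp
  qed
qed

section \<open>Moments and Nikodym distance in terms of the difference of indicators\<close>

lemma legendre_moment_diff:
  assumes K: "compact K" "K \<subseteq> {0..1} \<times> {0..1}" and L: "compact L" "L \<subseteq> {0..1} \<times> {0..1}"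
  shows "legendre_moment i j K - legendre_moment i j L =
    (\<integral>z. (indicator K z - indicator L z) * (unit_legendre i (fst z) * unit_legendre j (snd z)) \<partial>lborel)"
proof -
  have *: "integrable lborel (\<lambda>z. indicator S z * (unit_legendre i (fst z) * unit_legendre j (snd z)))"
    "legendre_moment i j S = (\<integral>z. indicator S z * (unit_legendre i (fst z) * unit_legendre j (snd z)) \<partial>lborel)"
    if S: "compact S" "S \<subseteq> {0..1} \<times> {0..1}" for S
  proof -
    have "bdd_supp ({0..1} \<times> {0..1}) (\<lambda>z. indicator S z * (unit_legendre i (fst z) * unit_legendre j (snd z)))"
      by (intro bdd_supp_mult bdd_supp_indicator bdd_supp_prod legendre.bdd borel_compact S)
    then show "integrable lborel (\<lambda>z. indicator S z * (unit_legendre i (fst z) * unit_legendre j (snd z)))"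
      by (rule bdd_supp_integrable[rotated]) (auto intro: compact_Times)
    \<comment> \<open>The cutoffs in \<open>unit_legendre\<close> equal 1 on \<open>S\<close>, which
      lies in the unit square.\<close>
    have "indicator S z *\<^sub>R (shifted_legendre i (fst z) * shifted_legendre j (snd z)) =
        indicator S z * (unit_legendre i (fst z) * unit_legendre j (snd z))" for z
      using S by (cases "z \<in> S") (auto simp: unit_legendre_def)
    then show "legendre_moment i j S =
        (\<integral>z. indicator S z * (unit_legendre i (fst z) * unit_legendre j (snd z)) \<partial>lborel)"
      by (simp only: legendre_moment_def set_lebesgue_integral_def)
  qed
  show ?thesis
    unfolding *(2)[OF K] *(2)[OF L] left_diff_distrib
    by (rule Bochner_Integration.integral_diff[symmetric]) (intro *(1) K L)+
qed

text \<open>The difference of two indicators takes only the values -1, 0 and 1, so its square is the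
  indicator of the symmetric difference. The area becomes a squared norm.\<close>

lemma nikodym_dist_eq_integral:
  assumes "compact K" "compact L"
  shows "nikodym_dist K L = (\<integral>z. (indicator K z - indicator L z)\<^sup>2 \<partial>lborel)"
proof -
  have "(indicator K z - indicator L z)\<^sup>2 = (indicator ((K - L) \<union> (L - K)) z :: real)" for z
    by (auto simp: indicator_def)
  then show ?thesis
    by (simp add: nikodym_dist_def)
qed

theorem theorem4p3:
  shows "\<exists>a\<^sub>1::real. a\<^sub>1 > 0 \<and>
    (\<forall>(N::nat) (\<epsilon>::real) (K::(real \<times> real) set) (L::(real \<times> real) set).
       \<epsilon> \<ge> 0 \<longrightarrow>
       convex_body K \<longrightarrow> K \<subseteq> {0..1} \<times> {0..1} \<longrightarrow>
       convex_body L \<longrightarrow> L \<subseteq> {0..1} \<times> {0..1} \<longrightarrow>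
       (\<Sum>i=0..N. \<Sum>j=0..N. \<bar>legendre_moment i j K - legendre_moment i j L\<bar> ^ 2) \<le> \<epsilon> ^ 2 \<longrightarrow>
       nikodym_dist K L \<le> \<epsilon> ^ 2 + a\<^sub>1 / (real N + 1))"
proof (intro exI[of _ 64] conjI allI impI)
  fix N :: nat and \<epsilon> :: real and K L :: "(real \<times> real) set"
  assume "convex_body K" "convex_body L" and K2: "K \<subseteq> {0..1} \<times> {0..1}" and L2: "L \<subseteq> {0..1} \<times> {0..1}"
    and moments: "(\<Sum>i=0..N. \<Sum>j=0..N. \<bar>legendre_moment i j K - legendre_moment i j L\<bar> ^ 2) \<le> \<epsilon> ^ 2"
  then have K: "compact K" "convex K" and L: "compact L" "convex L"
    by (auto simp: convex_body_def)
  define f :: "real \<times> real \<Rightarrow> real" where "f z = indicator K z - indicator L z" for z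
  have f: "bdd_supp ({0..1} \<times> {0..1}) f"
    unfolding f_def by (intro bdd_supp_diff bdd_supp_indicator borel_compact K L K2 L2)
  have "nikodym_dist K L = (\<integral>z. (f z)\<^sup>2 \<partial>lborel)"
    unfolding f_def by (rule nikodym_dist_eq_integral[OF K(1) L(1)])
  also have "\<dots> \<le> (\<Sum>i\<le>N. \<Sum>j\<le>N. (\<integral>z. f z * (unit_legendre i (fst z) * unit_legendre j (snd z)) \<partial>lborel)\<^sup>2)
      + 2 * (32 / (real N + 1)) * measure lborel {0..1::real}"
  proof (rule legendre.square_integral_le_of_sections[OF _ f])
    fix y :: real
    \<comment> \<open>A section may be empty even for \<open>y\<close> in [0, 1]; the empty set is
      compact and convex, so the one-dimensional estimate still applies.\<close>
    have "f (x, y) = indicator {x. (x, y) \<in> K} x - indicator {x. (x, y) \<in> L} x" for x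
      by (simp add: f_def indicator_def)
    then show "(\<integral>x. (f (x, y))\<^sup>2 \<partial>lborel) \<le>
        (\<Sum>i\<le>N. (\<integral>x. f (x, y) * unit_legendre i x \<partial>lborel)\<^sup>2) + 32 / (real N + 1)"
      using indicator_diff_Legendre_defect[OF compact_convex_sections(1-3)[OF K K2]
          compact_convex_sections(1-3)[OF L L2], of y y N] by simp
  next
    fix x :: real
    have "f (x, y) = indicator {y. (x, y) \<in> K} y - indicator {y. (x, y) \<in> L} y" for y
      by (simp add: f_def indicator_def)
    then show "(\<integral>y. (f (x, y))\<^sup>2 \<partial>lborel) \<le>
        (\<Sum>j\<le>N. (\<integral>y. f (x, y) * unit_legendre j y \<partial>lborel)\<^sup>2) + 32 / (real N + 1)"
      using indicator_diff_Legendre_defect[OF compact_convex_sections(4-6)[OF K K2]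
          compact_convex_sections(4-6)[OF L L2], of x x N] by simp
  qed auto
  \<comment> \<open>64 = 2 * 32, since [0, 1] has length 1.\<close>
  also have "\<dots> = (\<Sum>i=0..N. \<Sum>j=0..N. \<bar>legendre_moment i j K - legendre_moment i j L\<bar> ^ 2) + 64 / (real N + 1)"
    by (simp add: f_def legendre_moment_diff[OF K(1) K2 L(1) L2] atLeast0AtMost)
  finally show "nikodym_dist K L \<le> \<epsilon> ^ 2 + 64 / (real N + 1)"
    using moments by linarith
qed simp

end
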